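(* Let $X$ be a Hausdorff space, $D\subset X$ an open set with $\partial D\ne\emptyset$, and $\omega_\cdot^D$ a harmonic measure relative to $D$. Suppose $f\in L(\partial D;\omega_\cdot^D)\cap L^\infty(\partial D;\omega_\cdot^D)$. If there exists an $x_0\in D$ such that $$\omega^D_{x_0}(f)=\operatorname*{ess\,sup}_{y\in\partial D}f(y),$$ then $\omega^D_x(f)$ is constant for $x\in D$.
   Context: Measures: a measure on a set $Y$ is a map $\omega:2^Y\to[0,\infty]$ with $\omega(\emptyset)=0$ and $\omega(A)\le\sum_k\omega(A_k)$ whenever $A\subseteq\bigcup_{k=1}^\infty A_k$ (an outer measure); measurability is in the sense of Carathéodory; it is Borel if every Borel set is measurable. $\nu\ll\mu$ means $\mu(A)=0\Rightarrow\nu(A)=0$ for every $A\subseteq Y$. Write $\omega(f)=\int f\,\mathrm d\omega$. Pre-harmonic measure: a family of Borel measures $\{\omega^D_x:2^{\partial D}\to[0,1]:x\in D\}$ on $\partial D$ such that for every connected component $V$ of $D$: (1) $\omega_x^D(\partial V)=1$ for all $x\in V$; (2) $\omega^D_x\ll\omega^D_y$ for all $x,y\in V$. Harmonic measure: let $\mathcal F_x=\{E\Delta N: E\subseteq\partial D\text{ Borel},\ N\subseteq\partial D,\ \omega_x^D(N)=0\}$ and $\mathcal F=\bigcap_{x\in D}\mathcal F_x$. Extended real-valued functions measurable w.r.t. $\mathcal F$ are called $\omega_\cdot^D$-measurable. The pre-harmonic measure restricted to $\mathcal F$ is the harmonic measure $\omega_\cdot^D$ relative to $D$. $L(\partial D;\omega_\cdot^D)$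 is the set of $\omega_\cdot^D$-measurable $f$ on $\partial D$ integrable with respect to $\omega_x^D$ for every $x\in D$. A set $N$ is $\omega_\cdot^D$-null, written $\omega_\cdot^D(N)=0$, if $\omega_x^D(N)=0$ for every $x\in D$; $L^\infty(\partial D;\omega_\cdot^D)$ (essentially bounded $\omega_\cdot^D$-measurable functions) and $\operatorname{ess\,sup}$ are taken with respect to $\omega_\cdot^D$-null sets.
   Formalization: The claim is false for disconnected D (D=(0,1)∪(2,3), ω_x the point mass at 0 resp. 2, f=1 on {0,1}, 0 on {2,3}), so ω_x(f) is shown constant only on the connected component of D containing x_0, which is all of D when D is connected. *)

theory Defs
  imports "HOL-Analysis.Analysis"
begin

(* The space X is the universe of a t2_space type. A measure on Y is an outer measure on Pow Y;
   its values on sets that are not contained in Y are never used. *)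

definition outer_measure_on :: "'a set \<Rightarrow> ('a set \<Rightarrow> ennreal) \<Rightarrow> bool" where
  "outer_measure_on Y w \<longleftrightarrow>
     w {} = 0 \<and>
     (\<forall>A (B :: nat \<Rightarrow> 'a set).
        A \<subseteq> Y \<longrightarrow> range B \<subseteq> Pow Y \<longrightarrow> A \<subseteq> (\<Union>k. B k) \<longrightarrow> w A \<le> (\<Sum>k. w (B k)))"

(* lambda_system Y (Pow Y) w is the family of Caratheodory measurable subsets of Y. *)
definition borel_outer_measure_on ::
    "'a::topological_space set \<Rightarrow> ('a set \<Rightarrow> ennreal) \<Rightarrow> bool" where
  "borel_outer_measure_on Y w \<longleftrightarrow>
     outer_measure_on Y w \<and> sets (restrict_space borel Y) \<subseteq> lambda_system Y (Pow Y) w"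

(* Domination of nu by mu on all subsets of Y, not only on the measurable ones. *)
definition dominated_on ::
    "'a set \<Rightarrow> ('a set \<Rightarrow> ennreal) \<Rightarrow> ('a set \<Rightarrow> ennreal) \<Rightarrow> bool" where
  "dominated_on Y nu mu \<longleftrightarrow> (\<forall>A\<subseteq>Y. mu A = 0 \<longrightarrow> nu A = 0)"

(* w x A stands for the measure at x in D of a subset A of the boundary of D. Since w x lives on
   subsets of frontier D, the normalisation evaluates it at the part of frontier V inside
   frontier D. This is frontier V itself whenever frontier V is contained in frontier D, as is the
   case in locally connected spaces. *)
definition pre_harmonic_measure ::
    "'a::topological_space set \<Rightarrow> ('a \<Rightarrow> 'a set \<Rightarrow> ennreal) \<Rightarrow> bool" where
  "pre_harmonic_measure D w \<longleftrightarrow>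
     (\<forall>x\<in>D. borel_outer_measure_on (frontier D) (w x) \<and> (\<forall>A\<subseteq>frontier D. w x A \<le> 1)) \<and>
     (\<forall>V\<in>components D.
        (\<forall>x\<in>V. w x (frontier V \<inter> frontier D) = 1) \<and>
        (\<forall>x\<in>V. \<forall>y\<in>V. dominated_on (frontier D) (w x) (w y)))"

definition harmonic_sets_at ::
    "'a::topological_space set \<Rightarrow> ('a \<Rightarrow> 'a set \<Rightarrow> ennreal) \<Rightarrow> 'a \<Rightarrow> 'a set set" where
  "harmonic_sets_at D w x =
     {sym_diff E N | E N. E \<in> sets (restrict_space borel (frontier D)) \<and>
                          N \<subseteq> frontier D \<and> w x N = 0}"

definition harmonic_sets ::
    "'a::topological_space set \<Rightarrow> ('a \<Rightarrow> 'a set \<Rightarrow> ennreal) \<Rightarrow> 'a set set" where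
  "harmonic_sets D w = (\<Inter>x\<in>D. harmonic_sets_at D w x)"

definition harmonic_measure ::
    "'a::topological_space set \<Rightarrow> ('a \<Rightarrow> 'a set \<Rightarrow> ennreal) \<Rightarrow> 'a \<Rightarrow> 'a measure" where
  "harmonic_measure D w x = measure_of (frontier D) (harmonic_sets D w) (w x)"

definition harmonic_measurable ::
    "'a::topological_space set \<Rightarrow> ('a \<Rightarrow> 'a set \<Rightarrow> ennreal) \<Rightarrow> ('a \<Rightarrow> ereal) \<Rightarrow> bool" where
  "harmonic_measurable D w f \<longleftrightarrow> f \<in> borel_measurable (sigma (frontier D) (harmonic_sets D w))"

definition harmonic_null ::
    "'a::topological_space set \<Rightarrow> ('a \<Rightarrow> 'a set \<Rightarrow> ennreal) \<Rightarrow> 'a set \<Rightarrow> bool" where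
  "harmonic_null D w N \<longleftrightarrow> N \<subseteq> frontier D \<and> (\<forall>x\<in>D. w x N = 0)"

(* The Bochner integral does not apply to extended real-valued functions. Because e2ennreal sends
   negative numbers to 0, the two nonnegative integrals are those of the positive and the negative
   part. *)
definition ereal_integrable :: "'a measure \<Rightarrow> ('a \<Rightarrow> ereal) \<Rightarrow> bool" where
  "ereal_integrable M f \<longleftrightarrow>
     f \<in> borel_measurable M \<and>
     (\<integral>\<^sup>+y. e2ennreal (f y) \<partial>M) < \<infinity> \<and> (\<integral>\<^sup>+y. e2ennreal (- f y) \<partial>M) < \<infinity>"

definition ereal_integral :: "'a measure \<Rightarrow> ('a \<Rightarrow> ereal) \<Rightarrow> ereal" where
  "ereal_integral M f =
     enn2ereal (\<integral>\<^sup>+y. e2ennreal (f y) \<partial>M) - enn2ereal (\<integral>\<^sup>+y. e2ennreal (- f y) \<partial>M)"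

definition harmonic_L ::
    "'a::topological_space set \<Rightarrow> ('a \<Rightarrow> 'a set \<Rightarrow> ennreal) \<Rightarrow> ('a \<Rightarrow> ereal) set" where
  "harmonic_L D w =
     {f. harmonic_measurable D w f \<and> (\<forall>x\<in>D. ereal_integrable (harmonic_measure D w x) f)}"

definition harmonic_Linf ::
    "'a::topological_space set \<Rightarrow> ('a \<Rightarrow> 'a set \<Rightarrow> ennreal) \<Rightarrow> ('a \<Rightarrow> ereal) set" where
  "harmonic_Linf D w =
     {f. harmonic_measurable D w f \<and>
         (\<exists>C::real. harmonic_null D w {y \<in> frontier D. \<bar>f y\<bar> > ereal C})}"

(* The exceptional sets are null for all measures w x with x in D simultaneously, so this is not
   esssup of a single measure. *)
definition harmonic_esssup ::
    "'a::topological_space set \<Rightarrow> ('a \<Rightarrow> 'a set \<Rightarrow> ennreal) \<Rightarrow> ('a \<Rightarrow> ereal) \<Rightarrow> ereal" where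
  "harmonic_esssup D w f = Inf {c. harmonic_null D w {y \<in> frontier D. f y > c}}"

(* Maximum principle: the constancy of x |-> ereal_integral (harmonic_measure D w x) f has to be
   stated on the connected component of D that contains the point x0 where the essential supremum
   is attained; this component is all of D if D is connected. For disconnected D constancy on all
   of D fails: in the real line take D = (0,1) Un (2,3), let w x be the point mass at 0 for
   x in (0,1) and the point mass at 2 for x in (2,3), and let f = 1 on {0,1}, f = 0 on {2,3}.
   Then the integral equals the essential supremum 1 on (0,1), but it is 0 on (2,3). *)

end

(* The essential supremum m bounds f outside a set that is null for every w x, so if the mean of f
   at x0 equals m then f = m holds w x0-almost everywhere. Mutual absolute continuity on the
   component of x0 carries f = m over to every w x there, and then each mean of f is the mean of
   the constant m. *)
theory Submission
  imports Defs
begin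

section \<open>Outer measures and Caratheodory measurable sets\<close>

lemma outer_measure_on_mono:
  assumes "outer_measure_on Y w" "A \<subseteq> B" "B \<subseteq> Y"
  shows "w A \<le> w B"
proof -
  \<comment> \<open>Subadditivity is stated for sequences, so the single covering set
    \<open>B\<close> is padded with empty sets.\<close>
  define C where "C k = (if k = 0 then B else {})" for k :: nat
  have "A \<subseteq> Y" "range C \<subseteq> Pow Y" "A \<subseteq> (\<Union>k. C k)"
    using assms(2,3) by (auto simp: C_def)
  then have "w A \<le> (\<Sum>k. w (C k))"
    using assms(1) unfolding outer_measure_on_def by blast
  also have "(\<Sum>k. w (C k)) = (\<Sum>k\<in>{0}. w (C k))"
    using assms by (intro suminf_finite) (auto simp: C_def outer_measure_on_def)
  finally show ?thesis by (simp add: C_def)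
qed

lemma outer_measure_on_null_subset:
  assumes "outer_measure_on Y w" "A \<subseteq> B" "B \<subseteq> Y" "w B = 0"
  shows "w A = 0"
  using outer_measure_on_mono[OF assms(1-3)] assms(4) by simp

lemma outer_measure_on_null_UN:
  fixes N :: "nat \<Rightarrow> 'a set"
  assumes "outer_measure_on Y w" "\<And>k. N k \<subseteq> Y" "\<And>k. w (N k) = 0"
  shows "w (\<Union>k. N k) = 0"
proof -
  have "w (\<Union>k. N k) \<le> (\<Sum>k. w (N k))"
    using assms(1,2) unfolding outer_measure_on_def by (simp add: UN_least image_subset_iff)
  then show ?thesis using assms(3) by simp
qed

lemma outer_measure_space_Pow:
  assumes "outer_measure_on Y w"
  shows "outer_measure_space (Pow Y) w"
  unfolding outer_measure_space_def
proof (intro conjI)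
  show "positive (Pow Y) w"
    using assms by (simp add: positive_def outer_measure_on_def)
  show "increasing (Pow Y) w"
    using outer_measure_on_mono[OF assms] by (auto simp: increasing_def)
  show "countably_subadditive (Pow Y) w"
    using assms by (auto simp: countably_subadditive_def outer_measure_on_def)
qed

lemma measure_space_lambda_system:
  assumes "outer_measure_on Y w"
  shows "measure_space Y (lambda_system Y (Pow Y) w) w"
  using sigma_algebra.caratheodory_lemma[OF sigma_algebra_Pow outer_measure_space_Pow[OF assms]] .

text \<open>Caratheodory's sigma-algebra is complete: for any test set \<open>A\<close> the piece
  inside \<open>N\<close> is null by monotonicity, so by subadditivity the piece outside
  \<open>N\<close> already carries all of \<open>w A\<close>.\<close>

lemma null_in_lambda_system:
  assumes "outer_measure_on Y w" "N \<subseteq> Y" "w N = 0"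
  shows "N \<in> lambda_system Y (Pow Y) w"
  unfolding lambda_system_def
proof (intro CollectI conjI ballI)
  show "N \<in> Pow Y" using assms(2) by simp
  fix A assume A: "A \<in> Pow Y"
  have "w (N \<inter> A) = 0"
    using outer_measure_on_null_subset[OF assms(1) _ assms(2,3)] by simp
  moreover have "w ((Y - N) \<inter> A) \<le> w A"
    using A by (intro outer_measure_on_mono[OF assms(1)]) auto
  moreover have "w A \<le> w ((Y - N) \<inter> A) + w N"
  proof -
    have "subadditive (Pow Y) w"
      using outer_measure_space_Pow[OF assms(1)] algebra_Pow
      by (metis outer_measure_space_def ring_of_sets.countably_subadditive_subadditive
          algebra_def)
    then have "w (((Y - N) \<inter> A) \<union> (N \<inter> A)) \<le> w ((Y - N) \<inter> A) + w (N \<inter> A)"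
      using A by (intro subadditiveD) auto
    moreover have "((Y - N) \<inter> A) \<union> (N \<inter> A) = A" using A by auto
    ultimately show ?thesis using \<open>w (N \<inter> A) = 0\<close> assms(3) by simp
  qed
  ultimately show "w (N \<inter> A) + w ((Y - N) \<inter> A) = w A"
    using assms(3) by (metis add_0 add_0_right antisym)
qed

section \<open>The sigma-algebra of harmonic sets and the measures on it\<close>

lemma harmonic_sets_at_subset_lambda_system:
  assumes "borel_outer_measure_on (frontier D) (w x)"
  shows "harmonic_sets_at D w x \<subseteq> lambda_system (frontier D) (Pow (frontier D)) (w x)"
proof -
  let ?L = "lambda_system (frontier D) (Pow (frontier D)) (w x)"
  have om: "outer_measure_on (frontier D) (w x)"
    using assms by (simp add: borel_outer_measure_on_def)
  interpret sigma_algebra "frontier D" ?L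
    using measure_space_lambda_system[OF om] by (simp add: measure_space_def)
  \<comment> \<open>Borel sets are Caratheodory measurable by assumption and null sets by
    completeness; a sigma-algebra is closed under symmetric differences.\<close>
  show ?thesis
    unfolding harmonic_sets_at_def
    using assms null_in_lambda_system[OF om] by (auto simp: borel_outer_measure_on_def)
qed

text \<open>The null sets of an outer measure are closed under subsets and countable unions, so
  altering Borel sets by null sets preserves complements and countable unions.\<close>

lemma sigma_algebra_harmonic_sets_at:
  assumes "outer_measure_on (frontier D) (w x)"
  shows "sigma_algebra (frontier D) (harmonic_sets_at D w x)"
proof -
  let ?Y = "frontier D" and ?B = "restrict_space borel (frontier D)"
  have sp: "space ?B = ?Y" by (simp add: space_restrict_space)
  have sub: "E \<subseteq> ?Y" if "E \<in> sets ?B" for E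
    using sets.sets_into_space[OF that] sp by simp
  show ?thesis
    unfolding sigma_algebra_iff2
  proof (intro conjI ballI allI impI)
    show "harmonic_sets_at D w x \<subseteq> Pow ?Y"
      unfolding harmonic_sets_at_def using sub by auto
    show "{} \<in> harmonic_sets_at D w x"
      unfolding harmonic_sets_at_def using assms
      by (auto simp: outer_measure_on_def intro!: exI[of _ "{}"])
  next
    fix s assume "s \<in> harmonic_sets_at D w x"
    then obtain E N where s: "s = sym_diff E N" "E \<in> sets ?B" "N \<subseteq> ?Y" "w x N = 0"
      unfolding harmonic_sets_at_def by auto
    have "?Y - s = sym_diff (?Y - E) N" using s(1,3) sub[OF s(2)] by auto
    moreover have "?Y - E \<in> sets ?B" using sets.compl_sets[OF s(2)] sp by simp
    ultimately show "?Y - s \<in> harmonic_sets_at D w x"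
      unfolding harmonic_sets_at_def using s by blast
  next
    fix A :: "nat \<Rightarrow> 'a set" assume "range A \<subseteq> harmonic_sets_at D w x"
    then have "\<exists>E N. A k = sym_diff E N \<and> E \<in> sets ?B \<and> N \<subseteq> ?Y \<and> w x N = 0" for k
      unfolding harmonic_sets_at_def by (drule_tac c = "A k" in subsetD) auto
    then obtain E N where A: "\<And>k. A k = sym_diff (E k) (N k)" "\<And>k. E k \<in> sets ?B"
      "\<And>k. N k \<subseteq> ?Y" "\<And>k. w x (N k) = 0"
      by metis
    \<comment> \<open>\<open>M\<close> is the exact error made on replacing each \<open>A k\<close>
      by its Borel part \<open>E k\<close>. It lies in the union of the \<open>N k\<close>, hence is
      null and serves as the null part of the union.\<close>
    define M where "M = sym_diff (\<Union>k. A k) (\<Union>k. E k)"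
    have M: "M \<subseteq> (\<Union>k. N k)" unfolding M_def A(1) by auto
    have "(\<Union>k. N k) \<subseteq> ?Y" using A(3) by auto
    then have "w x M = 0" "M \<subseteq> ?Y"
      using outer_measure_on_null_subset[OF assms M] outer_measure_on_null_UN[OF assms A(3,4)] M
      by auto
    moreover have "(\<Union>k. A k) = sym_diff (\<Union>k. E k) M" unfolding M_def by auto
    moreover have "(\<Union>k. E k) \<in> sets ?B" using A(2) by auto
    ultimately show "(\<Union>k. A k) \<in> harmonic_sets_at D w x"
      unfolding harmonic_sets_at_def by blast
  qed
qed

text \<open>An intersection of sigma-algebras. For empty \<open>D\<close> the intersection would be
  the family of all sets of the type, not a family of subsets of the boundary.\<close>

lemma sigma_algebra_harmonic_sets:
  assumes "\<And>x. x \<in> D \<Longrightarrow> outer_measure_on (frontier D) (w x)" "D \<noteq> {}"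
  shows "sigma_algebra (frontier D) (harmonic_sets D w)"
  using sigma_algebra_harmonic_sets_at[where w = w, OF assms(1)] assms(2)
  unfolding harmonic_sets_def sigma_algebra_iff2
  by (intro conjI ballI allI impI INT_I) (blast, meson, meson INT_E, meson INT_lower subset_trans)

text \<open>\<open>measure_of\<close> yields the values of \<open>w x\<close> only if
  \<open>w x\<close> is countably additive on a sigma-algebra. Caratheodory's theorem gives
  additivity on the lambda system, and it is inherited by the smaller family
  \<open>harmonic_sets D w\<close>.\<close>

lemma
  assumes bom: "\<And>x. x \<in> D \<Longrightarrow> borel_outer_measure_on (frontier D) (w x)" and x: "x \<in> D"
  shows space_harmonic_measure: "space (harmonic_measure D w x) = frontier D"
    and sets_harmonic_measure: "sets (harmonic_measure D w x) = harmonic_sets D w"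
    and emeasure_harmonic_measure:
      "A \<in> harmonic_sets D w \<Longrightarrow> emeasure (harmonic_measure D w x) A = w x A"
proof -
  interpret sigma_algebra "frontier D" "harmonic_sets D w"
    using bom x by (intro sigma_algebra_harmonic_sets) (auto simp: borel_outer_measure_on_def)
  show "space (harmonic_measure D w x) = frontier D"
    unfolding harmonic_measure_def using space_closed by (rule space_measure_of)
  show sets: "sets (harmonic_measure D w x) = harmonic_sets D w"
    unfolding harmonic_measure_def by (rule sets_measure_of_eq)
  have ms: "measure_space (frontier D) (lambda_system (frontier D) (Pow (frontier D)) (w x)) (w x)"
    using bom[OF x] by (intro measure_space_lambda_system) (simp add: borel_outer_measure_on_def)
  have "harmonic_sets D w \<subseteq> lambda_system (frontier D) (Pow (frontier D)) (w x)"
    using harmonic_sets_at_subset_lambda_system[where w = w, OF bom[OF x]] x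
    unfolding harmonic_sets_def by blast
  with ms have "positive (harmonic_sets D w) (w x)" "countably_additive (harmonic_sets D w) (w x)"
    unfolding measure_space_def positive_def countably_additive_def by (auto dest: subset_trans)
  then show "emeasure (harmonic_measure D w x) A = w x A" if "A \<in> harmonic_sets D w"
    using that sigma_algebra_axioms unfolding harmonic_measure_def
    by (intro emeasure_measure_of_sigma)
qed

section \<open>Integrals of extended real-valued functions\<close>

lemma AE_finite_of_ereal_integrable:
  assumes "ereal_integrable M f"
  shows "AE y in M. \<bar>f y\<bar> \<noteq> \<infinity>"
proof -
  have [measurable]: "f \<in> borel_measurable M"
    using assms by (simp add: ereal_integrable_def)
  have "AE y in M. e2ennreal (f y) \<noteq> \<infinity>" "AE y in M. e2ennreal (- f y) \<noteq> \<infinity>"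
    using assms unfolding ereal_integrable_def by (intro nn_integral_PInf_AE; simp add: less_top)+
  then show ?thesis
    by eventually_elim (auto simp: infinity_ennreal_def)
qed

text \<open>Makes the linearity of the Bochner integral available. \<open>real_of_ereal\<close>
  sends both infinities to 0, which alters an integrable \<open>f\<close> only on a null
  set.\<close>

lemma
  assumes f: "ereal_integrable M f"
  shows integrable_real_of_ereal: "integrable M (\<lambda>y. real_of_ereal (f y))"
    and ereal_integral_eq_lebesgue_integral:
      "ereal_integral M f = ereal (\<integral>y. real_of_ereal (f y) \<partial>M)"
proof -
  let ?g = "\<lambda>y. real_of_ereal (f y)"
  have [measurable]: "f \<in> borel_measurable M"
    using f by (simp add: ereal_integrable_def)
  have fin: "AE y in M. \<bar>f y\<bar> \<noteq> \<infinity>" by (rule AE_finite_of_ereal_integrable[OF f])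
  have pos: "(\<integral>\<^sup>+y. ennreal (?g y) \<partial>M) = (\<integral>\<^sup>+y. e2ennreal (f y) \<partial>M)"
    using fin
    by (intro nn_integral_cong_AE)
      (auto elim!: eventually_mono simp flip: e2ennreal_ereal simp: ereal_real)
  have neg: "(\<integral>\<^sup>+y. ennreal (- ?g y) \<partial>M) = (\<integral>\<^sup>+y. e2ennreal (- f y) \<partial>M)"
    using fin
    by (intro nn_integral_cong_AE)
      (auto elim!: eventually_mono simp flip: e2ennreal_ereal uminus_ereal.simps simp: ereal_real)
  show int: "integrable M ?g"
    using f unfolding real_integrable_def pos neg by (auto simp: ereal_integrable_def)
  \<comment> \<open>Both parts have finite integral, so the difference in
    \<open>ereal_integral_def\<close> is one of real numbers.\<close>
  have enn: "enn2ereal p = ereal (enn2real p)" if "p < \<infinity>" for p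
    using that by (cases p) auto
  show "ereal_integral M f = ereal (\<integral>y. ?g y \<partial>M)"
    using f unfolding real_lebesgue_integral_def[OF int] pos neg ereal_integral_def
    by (auto simp: ereal_integrable_def enn)
qed

text \<open>Since the total mass is 1, the deficit \<open>c - f\<close> has integral 0; being
  nonnegative almost everywhere, it vanishes almost everywhere.\<close>

lemma AE_eq_of_ereal_integral_eq_upper_bound:
  assumes prob: "emeasure M (space M) = 1"
    and f: "ereal_integrable M f"
    and le: "AE y in M. f y \<le> c"
    and eq: "ereal_integral M f = c"
  shows "AE y in M. f y = c"
proof -
  interpret finite_measure M by (rule finite_measureI) (simp add: prob)
  let ?g = "\<lambda>y. real_of_ereal (f y)"
  \<comment> \<open>The integral of an integrable function is real, so \<open>c\<close> is finite
    and can be subtracted from.\<close>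
  obtain r where c: "c = ereal r"
    using eq ereal_integral_eq_lebesgue_integral[OF f] by metis
  have int: "integrable M ?g" by (rule integrable_real_of_ereal[OF f])
  have fin: "AE y in M. \<bar>f y\<bar> \<noteq> \<infinity>" by (rule AE_finite_of_ereal_integrable[OF f])
  have "(\<integral>y. r - ?g y \<partial>M) = 0"
    using eq ereal_integral_eq_lebesgue_integral[OF f] int
    by (simp add: c measure_def prob)
  moreover have "AE y in M. 0 \<le> r - ?g y"
    using fin le by eventually_elim (auto simp: c)
  ultimately have "AE y in M. r - ?g y = 0"
    using int by (subst (asm) integral_nonneg_eq_0_iff_AE) auto
  then show ?thesis
    using fin by eventually_elim (auto simp: c)
qed

text \<open>Used to compare means with respect to different measures: the right-hand side, which is
  \<open>c\<close> split into its positive and negative parts, does not involve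
  \<open>M\<close>.\<close>

lemma ereal_integral_AE_const:
  assumes prob: "emeasure M (space M) = 1" and ae: "AE y in M. f y = c"
  shows "ereal_integral M f = enn2ereal (e2ennreal c) - enn2ereal (e2ennreal (- c))"
proof -
  have "(\<integral>\<^sup>+y. e2ennreal (f y) \<partial>M) = (\<integral>\<^sup>+y. e2ennreal c \<partial>M)"
    "(\<integral>\<^sup>+y. e2ennreal (- f y) \<partial>M) = (\<integral>\<^sup>+y. e2ennreal (- c) \<partial>M)"
    using ae by (intro nn_integral_cong_AE; auto elim!: eventually_mono)+
  then show ?thesis by (simp add: ereal_integral_def prob)
qed

section \<open>The essential supremum and the maximum principle\<close>

lemma harmonic_null_gt_harmonic_esssup:
  assumes "\<And>x. x \<in> D \<Longrightarrow> outer_measure_on (frontier D) (w x)"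
  shows "harmonic_null D w {y \<in> frontier D. f y > harmonic_esssup D w f}"
proof -
  let ?S = "{c. harmonic_null D w {y \<in> frontier D. f y > c}}"
  \<comment> \<open>No value exceeds \<open>\<infinity>\<close>, so the exceptional set at this
    level is empty.\<close>
  have "\<infinity> \<in> ?S"
    using assms by (simp add: harmonic_null_def outer_measure_on_def)
  then have "?S \<noteq> {}" by blast
  \<comment> \<open>The infimum is attained along a sequence of admissible levels, so the set above
    it is a countable union of null sets.\<close>
  from Inf_countable_INF[OF this] obtain c :: "nat \<Rightarrow> ereal"
    where c: "range c \<subseteq> ?S" "Inf ?S = (INF i. c i)" by blast
  have eq: "{y \<in> frontier D. f y > harmonic_esssup D w f} = (\<Union>i. {y \<in> frontier D. f y > c i})"
    unfolding harmonic_esssup_def c(2) by (auto simp: INF_less_iff)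
  have "w x (\<Union>i. {y \<in> frontier D. f y > c i}) = 0" if "x \<in> D" for x
    using c(1) that by (intro outer_measure_on_null_UN[OF assms]) (auto simp: harmonic_null_def)
  then show ?thesis unfolding eq by (auto simp: harmonic_null_def)
qed

theorem theorem2p8:
  fixes D :: "'a::t2_space set"
    and w :: "'a \<Rightarrow> 'a set \<Rightarrow> ennreal"
    and f :: "'a \<Rightarrow> ereal"
    and x0 :: 'a
  assumes "open D"
    and "frontier D \<noteq> {}"
    and "pre_harmonic_measure D w"
    and "f \<in> harmonic_L D w \<inter> harmonic_Linf D w"
    and "x0 \<in> D"
    and "ereal_integral (harmonic_measure D w x0) f = harmonic_esssup D w f"
  shows "(\<lambda>x. ereal_integral (harmonic_measure D w x) f)
           constant_on connected_component_set D x0"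
proof -
  let ?Y = "frontier D" and ?V = "connected_component_set D x0"
    and ?M = "harmonic_measure D w" and ?c = "harmonic_esssup D w f"
  have bom: "\<And>x. x \<in> D \<Longrightarrow> borel_outer_measure_on ?Y (w x)"
    and le1: "\<And>x. x \<in> D \<Longrightarrow> w x ?Y \<le> 1"
    using assms(3) by (auto simp: pre_harmonic_measure_def)
  then have om: "\<And>x. x \<in> D \<Longrightarrow> outer_measure_on ?Y (w x)"
    by (simp add: borel_outer_measure_on_def)
  have V: "?V \<in> components D" using assms(5) by (auto simp: components_def)
  have VD: "?V \<subseteq> D" by (rule connected_component_subset)
  have x0V: "x0 \<in> ?V" using assms(5) by simp
  have comp: "(\<forall>x\<in>?V. w x (frontier ?V \<inter> ?Y) = 1) \<and>
      (\<forall>x\<in>?V. \<forall>y\<in>?V. dominated_on ?Y (w x) (w y))"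
    using assms(3) unfolding pre_harmonic_measure_def by (elim conjE) (rule bspec[OF _ V])
  have dom: "dominated_on ?Y (w x) (w y)" if "x \<in> ?V" "y \<in> ?V" for x y
    using bspec[OF bspec[OF conjunct2[OF comp] that(1)] that(2)] .
  have space: "space (?M x) = ?Y" and sets: "sets (?M x) = harmonic_sets D w"
    and emeasure: "A \<in> harmonic_sets D w \<Longrightarrow> emeasure (?M x) A = w x A" if "x \<in> D" for x A
    using space_harmonic_measure[of D w x] sets_harmonic_measure[of D w x]
      emeasure_harmonic_measure[of D w x A] bom that by blast+
  \<comment> \<open>The normalisation gives mass 1 to a part of the boundary, and the upper bound 1
    on \<open>w x\<close> then fixes the mass of all of it.\<close>
  have prob: "emeasure (?M x) (space (?M x)) = 1" if x: "x \<in> ?V" for x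
  proof -
    have xD: "x \<in> D" using x VD by blast
    have "1 = w x (frontier ?V \<inter> ?Y)"
      using bspec[OF conjunct1[OF comp] x] by (rule sym)
    also have "\<dots> \<le> w x ?Y" by (intro outer_measure_on_mono[OF om[OF xD]]) auto
    finally have "w x ?Y = 1" using le1[OF xD] by (rule antisym[rotated])
    moreover have "?Y \<in> harmonic_sets D w"
      using sets.top[of "?M x"] xD by (simp add: space sets)
    ultimately show ?thesis using xD by (simp add: space emeasure)
  qed
  have int: "ereal_integrable (?M x) f" if "x \<in> D" for x
    using assms(4) that by (simp add: harmonic_L_def)
  \<comment> \<open>All \<open>?M x\<close> with \<open>x\<close> in \<open>D\<close> share the same
    measurable sets, so measurability is checked at \<open>x0\<close> alone.\<close>
  have meas: "{y \<in> ?Y. P (f y)} \<in> harmonic_sets D w" if [measurable]: "Measurable.pred borel P" for P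
  proof -
    have [measurable]: "f \<in> borel_measurable (?M x0)"
      using int[OF assms(5)] by (simp add: ereal_integrable_def)
    have "{y \<in> space (?M x0). P (f y)} \<in> sets (?M x0)" by measurable
    then show ?thesis using assms(5) by (simp add: space sets)
  qed
  \<comment> \<open>Almost-everywhere statements become statements about the outer measure
    \<open>w x\<close>, the form in which \<open>dominated_on\<close> applies.\<close>
  have AE_iff: "(AE y in ?M x. P (f y)) \<longleftrightarrow> w x {y \<in> ?Y. \<not> P (f y)} = 0"
    if "x \<in> D" and [measurable]: "Measurable.pred borel P" for x P
    using that meas[of "\<lambda>z. \<not> P z"]
    by (subst AE_iff_measurable[where N = "{y \<in> ?Y. \<not> P (f y)}"]) (auto simp: space sets emeasure)
  have "AE y in ?M x0. f y \<le> ?c"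
    using harmonic_null_gt_harmonic_esssup[of D w f, OF om] assms(5)
    by (subst AE_iff[where P = "\<lambda>z. z \<le> ?c"]) (auto simp: harmonic_null_def not_le)
  then have "AE y in ?M x0. f y = ?c"
    using AE_eq_of_ereal_integral_eq_upper_bound[OF prob[OF x0V] int[OF assms(5)] _ assms(6)]
    by blast
  then have "w x0 {y \<in> ?Y. f y \<noteq> ?c} = 0"
    using assms(5) by (subst (asm) AE_iff[where P = "\<lambda>z. z = ?c"]) auto
  \<comment> \<open>Domination of \<open>w x\<close> by \<open>w x0\<close> is known only within one
    component, which is why constancy is obtained on \<open>?V\<close>.\<close>
  then have "w x {y \<in> ?Y. f y \<noteq> ?c} = 0" if "x \<in> ?V" for x
    using dom[OF that x0V] by (simp add: dominated_on_def)
  then have "AE y in ?M x. f y = ?c" if "x \<in> ?V" for x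
    using that VD by (subst AE_iff[where P = "\<lambda>z. z = ?c"]) auto
  then show ?thesis
    using ereal_integral_AE_const[OF prob] unfolding constant_on_def by blast
qed

end
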